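(* Consider the trust-region subproblem of minimizing $y^\top Qy+2g^\top y$ over $y\in\mathbb{R}^n$ subject to $\|y\|\le 1$ and $Ay-b\in\mathcal{K}$, where the additional constraints $Ay-b\in\mathcal{K}$ are linear ($\mathcal{K}=\mathbb{R}^m_+$) or conic quadratic ($\mathcal{K}\subseteq\mathbb{R}^m$ is a second-order cone or a direct product of second-order cones). Then the condition (S) there exists a vector $d\ne 0$ such that $Qd=\lambda_Q d$, $Ad\in\mathcal{K}$ and $g^\top d\le 0$ generalizes the dimensionality condition of Jeyakumar and Li (D) $\dim(\mathrm{Null}(Q-\lambda_Q I_n))\ge n-\dim(\mathrm{Null}(A))+1$; that is, whenever (D) holds, (S) holds.
   Context: $Q\in\mathbb{R}^{n\times n}$ is symmetric, $g\in\mathbb{R}^n$, $A\in\mathbb{R}^{m\times n}$, $b\in\mathbb{R}^m$. $\lambda_Q:=\lambda_{\min}(Q)$ is the minimum eigenvalue of $Q$, and it is assumed throughout that $\lambda_Q<0$ and that the feasible set $\{y\in\mathbb{R}^n:\|y\|\le 1,\ Ay-b\in\mathcal{K}\}$ is nonempty. $\|\cdot\|$ is the Euclidean norm, $I_n$ is the $n\times n$ identity matrix, $\mathrm{Null}(\cdot)$ denotes the nullspace of a matrix, and $\mathbb{R}^m_+$ is the nonnegative orthant. *)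

theory Defs
  imports "HOL-Analysis.Analysis"
begin

definition null_space :: "real^'n^'m \<Rightarrow> (real^'n) set" where
  "null_space M = {v. M *v v = 0}"

definition eigenvalues :: "real^'n^'n \<Rightarrow> real set" where
  "eigenvalues M = {\<mu>. \<exists>v. v \<noteq> 0 \<and> M *v v = \<mu> *\<^sub>R v}"

(* The set of real eigenvalues is always finite, and it is nonempty for symmetric M,
   the only case in which this is used. *)
definition min_eigenvalue :: "real^'n^'n \<Rightarrow> real" where
  "min_eigenvalue M = Min (eigenvalues M)"

definition nonneg_orthant :: "(real^'m) set" where
  "nonneg_orthant = {u. \<forall>i. 0 \<le> u $ i}"

(* The constraint that the coordinates of u indexed by B lie in the second-order cone of
   dimension card B, the coordinate j in B playing the role of the bound:
   norm ((u_i) for i in B - {j}) <= u_j. For B = {j} this reads 0 <= u_j. *)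
definition soc_block :: "'m set \<Rightarrow> 'm \<Rightarrow> (real^'m) \<Rightarrow> bool" where
  "soc_block B j u \<longleftrightarrow> sqrt (\<Sum>i\<in>B - {j}. (u $ i)\<^sup>2) \<le> u $ j"

definition second_order_cone :: "(real^'m) set \<Rightarrow> bool" where
  "second_order_cone K \<longleftrightarrow> (\<exists>j. K = {u. soc_block UNIV j u})"

(* The finite index type 'm carries no order. A decomposition of R^m into consecutive blocks,
   each with its last coordinate as the bound, under some enumeration of 'm, is the same as
   a partition P of 'm with a chosen element t B of every block B. *)
definition soc_product :: "(real^'m) set \<Rightarrow> bool" where
  "soc_product K \<longleftrightarrow>
     (\<exists>P t. partition_on UNIV P \<and> (\<forall>B\<in>P. t B \<in> B) \<and> K = {u. \<forall>B\<in>P. soc_block B (t B) u})"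

end

theory Submission
  imports Defs
begin

text \<open>Condition (D) says that the eigenspace of \<open>Q\<close> for its minimum eigenvalue
  and the nullspace of \<open>A\<close> have dimensions adding up to more than n, so they share a
  nonzero vector v (\<open>subspace_inter_nontrivial\<close>). Both v and -v are eigenvectors
  annihilated by \<open>A\<close>, and one of them has nonpositive inner product with
  \<open>g\<close>; this is d. Finally \<open>A *v d = 0\<close> lies in \<open>K\<close> by
  \<open>zero_in_cone\<close>.\<close>

lemma subspace_null_space: "subspace (null_space M)"
  unfolding null_space_def subspace_def
  by (simp add: matrix_vector_right_distrib matrix_vector_mult_scaleR)

text \<open>By the dimension formula, dim (S + T) + dim (S \<inter> T) = dim S + dim T. As S + T
  cannot exceed the ambient dimension, the excess must come from the intersection.\<close>

lemma subspace_inter_nontrivial: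
  fixes S T :: "'a::euclidean_space set"
  assumes "subspace S" "subspace T" "dim S + dim T > DIM('a)"
  obtains v where "v \<in> S" "v \<in> T" "v \<noteq> 0"
proof -
  have "dim {x + y |x y. x \<in> S \<and> y \<in> T} + dim (S \<inter> T) = dim S + dim T"
    using assms(1,2) by (rule dim_sums_Int)
  moreover have "dim {x + y |x y. x \<in> S \<and> y \<in> T} \<le> DIM('a)"
    by (rule dim_subset_UNIV)
  ultimately have "dim (S \<inter> T) \<noteq> 0"
    using assms(3) by linarith
  then have "\<not> S \<inter> T \<subseteq> {0}"
    by simp
  then show thesis
    using that by blast
qed

text \<open>At the origin every defining inequality, orthant or second-order block, reads 0 \<le>
  0.\<close>

lemma zero_in_cone:
  assumes "K = nonneg_orthant \<or> second_order_cone K \<or> soc_product K"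
  shows "0 \<in> K"
  using assms
  by (auto simp: nonneg_orthant_def second_order_cone_def soc_product_def soc_block_def)

theorem lemma6:
  fixes Q :: "real^'n^'n" and A :: "real^'n^'m"
    and g :: "real^'n" and b :: "real^'m" and K :: "(real^'m) set"
  assumes "transpose Q = Q"
    and "min_eigenvalue Q < 0"
    and "K = nonneg_orthant \<or> second_order_cone K \<or> soc_product K"
    and "{y. norm y \<le> 1 \<and> A *v y - b \<in> K} \<noteq> {}"
    and "int (dim (null_space (Q - min_eigenvalue Q *\<^sub>R mat 1)))
           \<ge> int CARD('n) - int (dim (null_space A)) + 1"
  shows "\<exists>d. d \<noteq> 0 \<and> Q *v d = min_eigenvalue Q *\<^sub>R d \<and> A *v d \<in> K \<and> g \<bullet> d \<le> 0"
proof -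
  let ?E = "null_space (Q - min_eigenvalue Q *\<^sub>R mat 1)"
  \<comment> \<open>The \<open>+ 1\<close> in (D) is what makes this inequality strict.\<close>
  have "dim ?E + dim (null_space A) > DIM(real^'n)"
    using assms(5) by simp
  then obtain v where v: "v \<in> ?E" "v \<in> null_space A" "v \<noteq> 0"
    using subspace_inter_nontrivial subspace_null_space by metis
  \<comment> \<open>Negation stays inside both subspaces and flips the sign of
    \<open>g \<bullet> v\<close>, so the linear condition costs only a choice of sign.\<close>
  define d where "d = (if g \<bullet> v \<le> 0 then v else - v)"
  have "d \<in> ?E" "d \<in> null_space A"
    using v subspace_neg[OF subspace_null_space] by (auto simp: d_def)
  then have "Q *v d = min_eigenvalue Q *\<^sub>R d" "A *v d = 0"
    by (simp_all add: null_space_def matrix_vector_mult_diff_rdistrib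
        scaleR_matrix_vector_assoc[symmetric])
  moreover have "d \<noteq> 0" "g \<bullet> d \<le> 0"
    using v(3) by (auto simp: d_def)
  ultimately show ?thesis
    using zero_in_cone[OF assms(3)] by auto
qed

end
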